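(* The mutually excited random walk with parameter $p=1$ is transient; that is, both processes $\{X_n\}$ and $\{Y_n\}$ are transient.
   Context: The mutually excited random walk (MERW) with parameter $p$ is a pair of $\mathbb{Z}$-valued processes $(X_n,Y_n)_{n\ge 0}$ with $X_0=Y_0=0$. Let $\mathcal{F}_n=\sigma(X_0,\dots,X_n,Y_0,\dots,Y_n)$. Set $w(0)=w(1)=\frac12$ and $w(j)=p$ for all integers $j\ge 2$. Conditionally on $\mathcal{F}_n$, the steps $X_{n+1}-X_n$ and $Y_{n+1}-Y_n$ are independent, take values in $\{-1,+1\}$, and satisfy $$\mathbf{P}[X_{n+1}=X_n+1\mid\mathcal{F}_n]=w\big(\#\{0\le m\le n:Y_m=X_n\}\big),\qquad \mathbf{P}[Y_{n+1}=Y_n+1\mid\mathcal{F}_n]=w\big(\#\{0\le m\le n:X_m=Y_n\}\big).$$ A $\mathbb{Z}$-valued process $\{\xi_n\}$ is transient if $\mathbf{P}(\forall z\in\mathbb{Z}\ \exists n\ \forall m>n:\ \xi_m\ne z)=1$. *)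

theory Defs
  imports "HOL-Probability.Probability"
begin

definition cond_probability :: "'a measure \<Rightarrow> 'a measure \<Rightarrow> 'a set \<Rightarrow> 'a \<Rightarrow> real" where
  "cond_probability M F A = real_cond_exp M F (indicator A)"

definition cond_indep_var ::
  "'a measure \<Rightarrow> 'a measure \<Rightarrow> 'b measure \<Rightarrow> ('a \<Rightarrow> 'b) \<Rightarrow> 'c measure \<Rightarrow> ('a \<Rightarrow> 'c) \<Rightarrow> bool" where
  "cond_indep_var M F Ma U Mb V \<longleftrightarrow>
     U \<in> measurable M Ma \<and> V \<in> measurable M Mb \<and>
     (\<forall>A\<in>sets Ma. \<forall>B\<in>sets Mb. AE \<omega> in M.
        cond_probability M F {\<omega> \<in> space M. U \<omega> \<in> A \<and> V \<omega> \<in> B} \<omega> =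
        cond_probability M F {\<omega> \<in> space M. U \<omega> \<in> A} \<omega> *
        cond_probability M F {\<omega> \<in> space M. V \<omega> \<in> B} \<omega>)"

text \<open>The integers carry the discrete sigma-algebra \<open>count_space UNIV\<close>.\<close>

definition merw_filtration ::
  "'a measure \<Rightarrow> (nat \<Rightarrow> 'a \<Rightarrow> int) \<Rightarrow> (nat \<Rightarrow> 'a \<Rightarrow> int) \<Rightarrow> nat \<Rightarrow> 'a measure" where
  "merw_filtration M X Y n = sigma (space M)
     ({X m -` A \<inter> space M | m A. m \<le> n} \<union> {Y m -` A \<inter> space M | m A. m \<le> n})"

definition merw_weight :: "real \<Rightarrow> nat \<Rightarrow> real" where
  "merw_weight p j = (if j \<le> 1 then 1 / 2 else p)"

text \<open>Sample-path requirements are imposed almost surely, which includes the case where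
  they hold everywhere.\<close>

locale mutually_excited_random_walk = prob_space M
  for M :: "'a measure" +
  fixes X Y :: "nat \<Rightarrow> 'a \<Rightarrow> int" and p :: real
  assumes X_measurable: "\<And>n. X n \<in> measurable M (count_space UNIV)"
    and Y_measurable: "\<And>n. Y n \<in> measurable M (count_space UNIV)"
    and start: "AE \<omega> in M. X 0 \<omega> = 0 \<and> Y 0 \<omega> = 0"
    and steps: "\<And>n. AE \<omega> in M. X (Suc n) \<omega> - X n \<omega> \<in> {-1, 1} \<and> Y (Suc n) \<omega> - Y n \<omega> \<in> {-1, 1}"
    and steps_cond_indep: "\<And>n. cond_indep_var M (merw_filtration M X Y n)
          (count_space UNIV) (\<lambda>\<omega>. X (Suc n) \<omega> - X n \<omega>)
          (count_space UNIV) (\<lambda>\<omega>. Y (Suc n) \<omega> - Y n \<omega>)"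
    and X_step: "\<And>n. AE \<omega> in M.
          cond_probability M (merw_filtration M X Y n) {\<omega> \<in> space M. X (Suc n) \<omega> = X n \<omega> + 1} \<omega>
          = merw_weight p (card {m. m \<le> n \<and> Y m \<omega> = X n \<omega>})"
    and Y_step: "\<And>n. AE \<omega> in M.
          cond_probability M (merw_filtration M X Y n) {\<omega> \<in> space M. Y (Suc n) \<omega> = Y n \<omega> + 1} \<omega>
          = merw_weight p (card {m. m \<le> n \<and> X m \<omega> = Y n \<omega>})"

text \<open>\<open>real_cond_exp\<close> is constantly 0 unless its second argument is a subalgebra of the first;
  this is satisfied here.\<close>

lemma subalgebra_merw_filtration:
  assumes "\<And>n. X n \<in> measurable M (count_space UNIV)"
    and "\<And>n. Y n \<in> measurable M (count_space UNIV)"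
  shows "subalgebra M (merw_filtration M X Y n)"
proof -
  let ?G = "{X m -` A \<inter> space M | m A. m \<le> n} \<union> {Y m -` A \<inter> space M | m A. m \<le> n}"
  have "?G \<subseteq> sets M"
    using assms by (auto intro: measurable_sets)
  moreover have "?G \<subseteq> Pow (space M)"
    by auto
  ultimately show ?thesis
    unfolding subalgebra_def merw_filtration_def
    by (simp add: sets.sigma_sets_subset)
qed

definition transient :: "'a measure \<Rightarrow> (nat \<Rightarrow> 'a \<Rightarrow> int) \<Rightarrow> bool" where
  "transient M \<xi> \<longleftrightarrow> measure M {\<omega> \<in> space M. \<forall>z. \<exists>n. \<forall>m>n. \<xi> m \<omega> \<noteq> z} = 1"

end

theory Submission
  imports Defs
begin

text \<open>Given the past, each walk moves right with probability at least \<open>1/2\<close>: always from a site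
  the other walk has visited twice, and with probability exactly \<open>1/2\<close> otherwise.  Hence almost
  surely each walk is unbounded above, by comparison with the simple random walk; moves right
  infinitely often from every site it visits infinitely often; and, by a conditional Borel-Cantelli
  argument, moves left infinitely often if it is infinitely often at a site the other
  walk has visited at most once.  On the event that these properties hold, transience is a
  deterministic statement about pairs of integer paths.\<close>

subsection \<open>Conditional Borel-Cantelli and level crossing\<close>

lemma sets_Collect_count_space:
  assumes "f \<in> measurable N (count_space UNIV)"
  shows "{\<omega>\<in>space N. P (f \<omega>)} \<in> sets N"
proof -
  have "f -` Collect P \<inter> space N \<in> sets N"
    by (rule measurable_sets[OF assms]) simp
  also have "f -` Collect P \<inter> space N = {\<omega>\<in>space N. P (f \<omega>)}"
    by blast
  finally show ?thesis .
qed

text \<open>Each time in the window at which \<open>A\<close> occurs together with \<open>B\<close>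
  costs a factor 1/2. The set \<open>C\<close> is an arbitrary event of the past, so the induction
  on the window length \<open>j\<close> can restart at time \<open>Suc n\<close> with what is left
  of \<open>C\<close> after time \<open>n\<close>.\<close>

lemma (in finite_measure) measure_halving_le:
  assumes sub: "\<And>n. sets (F n) \<subseteq> sets M"
    and mono: "\<And>n. sets (F n) \<subseteq> sets (F (Suc n))"
    and A: "\<And>n. A n \<in> sets (F n)" and B: "\<And>n. B n \<in> sets (F (Suc n))"
    and half: "\<And>n C. C \<in> sets (F n) \<Longrightarrow> C \<subseteq> A n \<Longrightarrow> measure M (C \<inter> B n) \<le> measure M C / 2"
    and C: "C \<in> sets (F n)"
  shows "measure M (C \<inter> {\<omega>\<in>space M. (\<forall>m\<in>{n..<n+j}. \<omega> \<in> A m \<longrightarrow> \<omega> \<in> B m)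
            \<and> k \<le> card {m\<in>{n..<n+j}. \<omega> \<in> A m}}) \<le> measure M C / 2 ^ k"
  using C
proof (induction j arbitrary: C n k)
  case 0
  then show ?case
    using sub by (cases k) (auto intro!: finite_measure_mono)
next
  case (Suc j)
  define E where "E n j k = {\<omega>\<in>space M. (\<forall>m\<in>{n..<n+j}. \<omega> \<in> A m \<longrightarrow> \<omega> \<in> B m)
            \<and> k \<le> card {m\<in>{n..<n+j}. \<omega> \<in> A m}}" for n j k
  have [measurable]: "A n \<in> sets M" "B n \<in> sets M" for n
    using A B sub by blast+
  have [measurable]: "E n j k \<in> sets M" for n j k
    unfolding E_def by measurable
  have CM [measurable]: "C \<in> sets M"
    using Suc.prems sub by blast
  show ?case
  proof (cases k)
    case 0
    then show ?thesis
      by (auto intro!: finite_measure_mono)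
  next
    case (Suc k')
    \<comment> \<open>Off \<open>A n\<close>, time \<open>n\<close> is not counted and
      \<open>k\<close> occurrences are still due; on \<open>A n\<close> the event forces
      \<open>B n\<close>, and \<open>k' = k - 1\<close> occurrences remain.\<close>
    let ?C1 = "C - A n" and ?C2 = "(C \<inter> A n) \<inter> B n"
    have C1: "?C1 \<in> sets (F n)" and CA: "C \<inter> A n \<in> sets (F n)"
      using Suc.prems A by auto
    have C1': "?C1 \<in> sets (F (Suc n))" and C2': "?C2 \<in> sets (F (Suc n))"
      using C1 CA mono B by blast+
    have card: "card {m\<in>{n..<n + Suc j}. \<omega> \<in> A m}
        = (if \<omega> \<in> A n then Suc else id) (card {m\<in>{Suc n..<Suc n + j}. \<omega> \<in> A m})" for \<omega>
    proof -
      have "{m\<in>{n..<n + Suc j}. \<omega> \<in> A m}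
          = (if \<omega> \<in> A n then insert n else id) {m\<in>{Suc n..<Suc n + j}. \<omega> \<in> A m}"
        using le_eq_less_or_eq by (auto simp: Suc_le_eq)
      then show ?thesis
        by auto
    qed
    have "C \<inter> E n (Suc j) k \<subseteq> (?C1 \<inter> E (Suc n) j k) \<union> (?C2 \<inter> E (Suc n) j k')"
    proof
      fix \<omega> assume "\<omega> \<in> C \<inter> E n (Suc j) k"
      then show "\<omega> \<in> (?C1 \<inter> E (Suc n) j k) \<union> (?C2 \<inter> E (Suc n) j k')"
        unfolding E_def card using Suc by (auto split: if_splits)
    qed
    then have "measure M (C \<inter> E n (Suc j) k)
        \<le> measure M (?C1 \<inter> E (Suc n) j k) + measure M (?C2 \<inter> E (Suc n) j k')"
      by (intro order_trans[OF finite_measure_mono measure_Un_le]) auto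
    also have "\<dots> \<le> measure M ?C1 / 2 ^ k + measure M ?C2 / 2 ^ k'"
      unfolding E_def by (intro add_mono Suc.IH C1' C2')
    also have "measure M ?C2 / 2 ^ k' \<le> measure M (C \<inter> A n) / 2 / 2 ^ k'"
      by (intro divide_right_mono half CA) auto
    \<comment> \<open>The factor 1/2 gained on \<open>A n\<close> turns \<open>2 ^ k'\<close> into
      \<open>2 ^ k\<close>, so the two pieces of \<open>C\<close> add up.\<close>
    also have "measure M ?C1 / 2 ^ k + measure M (C \<inter> A n) / 2 / 2 ^ k' = measure M C / 2 ^ k"
      using finite_measure_Diff'[of C "A n"] Suc by (simp add: field_simps)
    finally show ?thesis
      unfolding E_def by simp
  qed
qed

text \<open>Conditional Borel-Cantelli: if \<open>A\<close> recurs and is accompanied by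
  \<open>B\<close> at all times from some \<open>n\<close> on, then arbitrarily many factors 1/2
  accumulate, so this has measure zero for each \<open>n\<close>; there are countably many
  \<open>n\<close>.\<close>

lemma (in finite_measure) AE_frequently_not_if_halving:
  assumes sub: "\<And>n. sets (F n) \<subseteq> sets M" and space: "\<And>n. space (F n) = space M"
    and mono: "\<And>n. sets (F n) \<subseteq> sets (F (Suc n))"
    and A: "\<And>n. A n \<in> sets (F n)" and B: "\<And>n. B n \<in> sets (F (Suc n))"
    and half: "\<And>n C. C \<in> sets (F n) \<Longrightarrow> C \<subseteq> A n \<Longrightarrow> measure M (C \<inter> B n) \<le> measure M C / 2"
  shows "AE \<omega> in M. (\<exists>\<^sub>\<infinity>n. \<omega> \<in> A n) \<longrightarrow> (\<exists>\<^sub>\<infinity>n. \<omega> \<in> A n \<and> \<omega> \<notin> B n)"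
proof -
  have [measurable]: "A n \<in> sets M" "B n \<in> sets M" for n
    using A B sub by blast+
  have "AE \<omega> in M. \<not> ((\<forall>m\<ge>n. \<omega> \<in> A m \<longrightarrow> \<omega> \<in> B m) \<and> (\<forall>i. \<exists>m\<ge>i. \<omega> \<in> A m))" for n
  proof -
    let ?W = "{\<omega>\<in>space M. (\<forall>m\<ge>n. \<omega> \<in> A m \<longrightarrow> \<omega> \<in> B m) \<and> (\<forall>i. \<exists>m\<ge>i. \<omega> \<in> A m)}"
    have "measure M ?W \<le> measure M (space M) / 2 ^ k" for k
    proof -
      \<comment> \<open>\<open>V j\<close> is the part of \<open>?W\<close> on which
        \<open>A\<close> has already occurred \<open>k\<close> times in the first \<open>j\<close>
        steps from \<open>n\<close>. It increases to \<open>?W\<close> because \<open>A\<close>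
        recurs there, and \<open>measure_halving_le\<close> bounds each \<open>V j\<close>.\<close>
      define V where "V j = ?W \<inter> {\<omega>. k \<le> card {m\<in>{n..<n+j}. \<omega> \<in> A m}}" for j
      have V_space: "V j = {\<omega>\<in>?W. k \<le> card {m\<in>{n..<n+j}. \<omega> \<in> A m}}" for j
        by (auto simp: V_def)
      have V [measurable]: "V j \<in> sets M" for j
        unfolding V_space by measurable
      have "incseq V"
        unfolding V_def mono_def
        by (auto intro: order_trans[OF _ card_mono])
      moreover have "?W \<subseteq> (\<Union>j. V j)"
      proof
        fix \<omega> assume w: "\<omega> \<in> ?W"
        then have "\<exists>\<^sub>\<infinity>m. \<omega> \<in> A m"
          by (auto simp: INFM_nat_le)
        then have "infinite ({m. \<omega> \<in> A m} - {..<n})"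
          unfolding frequently_cofinite by (intro Diff_infinite_finite) auto
        then obtain T where T: "T \<subseteq> {m. \<omega> \<in> A m} - {..<n}" "finite T" "card T = k"
          using infinite_arbitrarily_large by blast
        obtain b where "\<forall>m\<in>T. m < b"
          using T(2) finite_nat_set_iff_bounded by blast
        then have "T \<subseteq> {m\<in>{n..<n+b}. \<omega> \<in> A m}"
          using T(1) by fastforce
        then have "\<omega> \<in> V b"
          using w T(3) by (auto simp: V_def intro!: card_mono)
        then show "\<omega> \<in> (\<Union>j. V j)"
          by blast
      qed
      then have "?W = (\<Union>j. V j)"
        unfolding V_def by blast
      ultimately have "(\<lambda>j. measure M (V j)) \<longlonglongrightarrow> measure M ?W"
        using finite_Lim_measure_incseq[of V] V by (simp add: image_subset_iff)
      moreover have "measure M (V j) \<le> measure M (space M) / 2 ^ k" for j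
      proof -
        have "measure M (V j) \<le> measure M (space M \<inter> {\<omega>\<in>space M. (\<forall>m\<in>{n..<n+j}. \<omega> \<in> A m \<longrightarrow> \<omega> \<in> B m)
            \<and> k \<le> card {m\<in>{n..<n+j}. \<omega> \<in> A m}})"
          by (intro finite_measure_mono) (auto simp: V_def)
        also have "\<dots> \<le> measure M (space M) / 2 ^ k"
          by (rule measure_halving_le[where F=F])
            (use sub mono A B half sets.top[of "F n"] space in auto)
        finally show ?thesis .
      qed
      ultimately show ?thesis
        by (intro LIMSEQ_le_const2) auto
    qed
    moreover have "(\<lambda>k. measure M (space M) / 2 ^ k) \<longlonglongrightarrow> 0"
      by (rule LIMSEQ_divide_realpow_zero) simp
    ultimately have "measure M ?W \<le> 0"
      by (intro LIMSEQ_le_const) auto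
    then have "measure M ?W = 0"
      by (simp add: measure_le_0_iff)
    moreover have "?W \<in> sets M"
      by measurable
    ultimately show ?thesis
      by (intro AE_I[where N="?W"]) (auto simp: emeasure_eq_measure)
  qed
  then have "AE \<omega> in M. \<forall>n. \<not> ((\<forall>m\<ge>n. \<omega> \<in> A m \<longrightarrow> \<omega> \<in> B m) \<and> (\<forall>i. \<exists>m\<ge>i. \<omega> \<in> A m))"
    unfolding AE_all_countable by blast
  then show ?thesis
    by eventually_elim (auto simp: INFM_nat_le)
qed

section \<open>Reaching a level: comparison with the simple random walk\<close>

text \<open>\<open>stay_below n d\<close> is the probability that a simple symmetric random walk started at
  distance \<open>d\<close> below a level does not hit this level within \<open>n\<close> steps.\<close>

fun stay_below :: "nat \<Rightarrow> nat \<Rightarrow> real" where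
  "stay_below n 0 = 0"
| "stay_below 0 (Suc d) = 1"
| "stay_below (Suc n) (Suc d) = (stay_below n d + stay_below n (Suc (Suc d))) / 2"

lemma stay_below_bounds: "0 \<le> stay_below n d" "stay_below n d \<le> 1"
  by (induction n d rule: stay_below.induct) auto

text \<open>Starting farther below the level makes avoiding it more likely. This is what allows a
  walk biased to the right to be compared with the symmetric one.\<close>

lemma stay_below_mono: "d \<le> e \<Longrightarrow> stay_below n d \<le> stay_below n e"
proof -
  have "stay_below n d \<le> stay_below n (Suc d)" for d
  proof (induction n arbitrary: d)
    case 0
    show ?case by (cases d) auto
  next
    case (Suc n)
    show ?case
    proof (cases d)
      case 0
      then show ?thesis by (simp add: stay_below_bounds)
    next
      case (Suc d')
      then show ?thesis
        using Suc.IH[of d'] Suc.IH[of "Suc (Suc d')"] by simp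
    qed
  qed
  then show "d \<le> e \<Longrightarrow> stay_below n d \<le> stay_below n e"
    by (rule lift_Suc_mono_le)
qed

lemma stay_below_Suc_le: "stay_below (Suc n) d \<le> stay_below n d"
proof (induction n arbitrary: d)
  case 0
  show ?case by (cases d) (auto simp: stay_below_bounds intro: order_trans[OF add_mono])
next
  case (Suc n)
  show ?case
  proof (cases d)
    case (Suc d')
    show ?thesis
      unfolding Suc using Suc.IH[of d'] Suc.IH[of "Suc (Suc d')"] stay_below.simps(3)[of "Suc n" d']
        stay_below.simps(3)[of n d'] by argo
  qed simp
qed

text \<open>The limit is a bounded harmonic function on the half-line vanishing at \<open>0\<close>, hence linear
  and bounded.\<close>

lemma stay_below_tendsto_0: "(\<lambda>n. stay_below n d) \<longlonglongrightarrow> 0"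
proof -
  have "\<exists>L. (\<lambda>n. stay_below n d) \<longlonglongrightarrow> L" for d
    using decseq_convergent[of "\<lambda>n. stay_below n d" 0]
    by (metis stay_below_bounds(1) stay_below_Suc_le decseq_SucI)
  then obtain L where L: "\<And>d. (\<lambda>n. stay_below n d) \<longlonglongrightarrow> L d"
    by metis
  have L0: "L 0 = 0"
    using L[of 0] by (simp add: LIMSEQ_const_iff)
  have harmonic: "L (Suc d) = (L d + L (Suc (Suc d))) / 2" for d
  proof (rule LIMSEQ_unique)
    show "(\<lambda>n. stay_below (Suc n) (Suc d)) \<longlonglongrightarrow> L (Suc d)"
      using L[of "Suc d"] by (rule LIMSEQ_Suc)
    show "(\<lambda>n. stay_below (Suc n) (Suc d)) \<longlonglongrightarrow> (L d + L (Suc (Suc d))) / 2"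
      unfolding stay_below.simps by (intro tendsto_intros L) auto
  qed
  \<comment> \<open>The recurrence is of second order, so the induction carries two consecutive
    values.\<close>
  have linear: "L d = d * L 1 \<and> L (Suc d) = Suc d * L 1" for d
  proof (induction d)
    case (Suc d)
    then show ?case
      using harmonic[of d] by (simp add: algebra_simps)
  qed (simp add: L0)
  have L_bounds: "0 \<le> L d" "L d \<le> 1" for d
    using L[of d] stay_below_bounds by (auto intro: LIMSEQ_le_const LIMSEQ_le_const2)
  have "L 1 = 0"
  proof (rule ccontr)
    assume "L 1 \<noteq> 0"
    then have "0 < L 1"
      using L_bounds[of 1] by simp
    \<comment> \<open>A positive slope would push the linear function above the bound 1.\<close>
    then obtain d :: nat where "1 < d * L 1"
      using reals_Archimedean3 by blast
    then show False
      using linear[of d] L_bounds[of d] by simp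
  qed
  then show ?thesis
    using L[of d] linear[of d] by simp
qed

text \<open>Condition on the next step. A right step has at least half the mass and leads to the
  more favourable distance, so the symmetric split is the worst case, and it reproduces the
  recursion of \<open>stay_below\<close>. Fixing \<open>Z n\<close> on \<open>C\<close> makes the
  distance a number.\<close>

lemma (in finite_measure) measure_below_level_le:
  fixes Z :: "nat \<Rightarrow> 'a \<Rightarrow> int"
  assumes sub: "\<And>n. sets (F n) \<subseteq> sets M" and space: "\<And>n. space (F n) = space M"
    and mono: "\<And>n. sets (F n) \<subseteq> sets (F (Suc n))"
    and Z: "\<And>n. Z n \<in> measurable (F n) (count_space UNIV)"
    and steps: "\<And>n. AE \<omega> in M. Z (Suc n) \<omega> - Z n \<omega> \<in> {-1, 1}"
    and half: "\<And>n C. C \<in> sets (F n) \<Longrightarrow>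
      measure M C / 2 \<le> measure M (C \<inter> {\<omega>\<in>space M. Z (Suc n) \<omega> = Z n \<omega> + 1})"
    and C: "C \<in> sets (F n)" "\<And>\<omega>. \<omega> \<in> C \<Longrightarrow> Z n \<omega> = K - int d"
  shows "measure M (C \<inter> {\<omega>\<in>space M. \<forall>m\<in>{n..n+j}. Z m \<omega> < K}) \<le> stay_below j d * measure M C"
  using C
proof (induction j arbitrary: C n d)
  case 0
  have "C \<in> sets M"
    using 0(1) sub by blast
  moreover have "C \<inter> {\<omega>\<in>space M. \<forall>m\<in>{n..n+0}. Z m \<omega> < K} = {}" if "d = 0"
    using 0(2) that by fastforce
  ultimately show ?case
    by (cases d) (auto intro!: finite_measure_mono)
next
  case (Suc j)
  have ZM [measurable]: "Z n \<in> measurable M (count_space UNIV)" for n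
    using measurable_mono[of "count_space UNIV" "count_space UNIV" "F n" M] Z sub space by auto
  have [measurable]: "C \<in> sets M"
    using Suc.prems sub by blast
  show ?case
  proof (cases d)
    case 0
    then have "C \<inter> {\<omega>\<in>space M. \<forall>m\<in>{n..n + Suc j}. Z m \<omega> < K} = {}"
      using Suc.prems(2) by fastforce
    then show ?thesis
      using 0 by simp
  next
    case (Suc d')
    define E where "E n j = {\<omega>\<in>space M. \<forall>m\<in>{n..n+j}. Z m \<omega> < K}" for n j
    have [measurable]: "E n j \<in> sets M" for n j
      unfolding E_def by measurable
    let ?R = "C \<inter> {\<omega>\<in>space M. Z (Suc n) \<omega> = K - int d'}"
    let ?L = "C \<inter> {\<omega>\<in>space M. Z (Suc n) \<omega> = K - int (Suc (Suc d'))}"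
    have "{\<omega>\<in>space M. Z (Suc n) \<omega> = a} \<in> sets (F (Suc n))" for a
      using sets_Collect_count_space[OF Z[of "Suc n"], of "\<lambda>z. z = a"] by (simp only: space)
    then have RL: "?R \<in> sets (F (Suc n))" "?L \<in> sets (F (Suc n))"
      using Suc.prems(1) mono by (blast intro: sets.Int)+
    have R: "?R = C \<inter> {\<omega>\<in>space M. Z (Suc n) \<omega> = Z n \<omega> + 1}"
      using Suc.prems(2) Suc by auto
    have [measurable]: "?R \<in> sets M" "?L \<in> sets M"
      using RL sub by blast+
    have "measure M (C \<inter> E n (Suc j)) \<le> measure M ((?R \<inter> E (Suc n) j) \<union> (?L \<inter> E (Suc n) j))"
    proof (rule finite_measure_mono_AE)
      show "AE \<omega> in M. \<omega> \<in> C \<inter> E n (Suc j) \<longrightarrow> \<omega> \<in> (?R \<inter> E (Suc n) j) \<union> (?L \<inter> E (Suc n) j)"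
        using steps[of n]
      proof eventually_elim
        case (elim \<omega>)
        then show ?case
          using Suc.prems(2)[of \<omega>] Suc by (auto simp: E_def)
      qed
    qed measurable
    also have "\<dots> \<le> measure M (?R \<inter> E (Suc n) j) + measure M (?L \<inter> E (Suc n) j)"
      by (intro measure_Un_le) auto
    also have "\<dots> \<le> stay_below j d' * measure M ?R + stay_below j (Suc (Suc d')) * measure M ?L"
      unfolding E_def by (intro add_mono Suc.IH RL) auto
    also have "\<dots> \<le> stay_below j d' * measure M ?R
        + stay_below j (Suc (Suc d')) * (measure M C - measure M ?R)"
    proof -
      \<comment> \<open>The left part has at most the mass that the right part leaves over, the two
        being disjoint subsets of \<open>C\<close>.\<close>
      have "measure M ?R + measure M ?L = measure M (?R \<union> ?L)"
        by (intro finite_measure_Union[symmetric]) auto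
      also have "\<dots> \<le> measure M C"
        by (intro finite_measure_mono) auto
      finally show ?thesis
        by (intro add_left_mono mult_left_mono stay_below_bounds) auto
    qed
    also have "\<dots> \<le> stay_below (Suc j) d * measure M C"
    proof -
      \<comment> \<open>This product is exactly the difference of the two sides of the
        claim.\<close>
      have "0 \<le> (stay_below j (Suc (Suc d')) - stay_below j d') * (measure M ?R - measure M C / 2)"
        using half[OF Suc.prems(1)] stay_below_mono[of d' "Suc (Suc d')" j]
        unfolding R by (intro mult_nonneg_nonneg) auto
      then show ?thesis
        using Suc by (simp add: algebra_simps)
    qed
    finally show ?thesis
      unfolding E_def .
  qed
qed

text \<open>Staying below a fixed level for \<open>j\<close> steps has measure at most a constant
  times \<open>stay_below j d\<close>, which tends to 0; there are countably many levels.\<close>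

lemma (in finite_measure) AE_exceeds_level:
  fixes Z :: "nat \<Rightarrow> 'a \<Rightarrow> int"
  assumes sub: "\<And>n. sets (F n) \<subseteq> sets M" and space: "\<And>n. space (F n) = space M"
    and mono: "\<And>n. sets (F n) \<subseteq> sets (F (Suc n))"
    and Z: "\<And>n. Z n \<in> measurable (F n) (count_space UNIV)"
    and steps: "\<And>n. AE \<omega> in M. Z (Suc n) \<omega> - Z n \<omega> \<in> {-1, 1}"
    and half: "\<And>n C. C \<in> sets (F n) \<Longrightarrow>
      measure M C / 2 \<le> measure M (C \<inter> {\<omega>\<in>space M. Z (Suc n) \<omega> = Z n \<omega> + 1})"
    and start: "AE \<omega> in M. Z 0 \<omega> = a"
  shows "AE \<omega> in M. \<forall>K. \<exists>n. K \<le> Z n \<omega>"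
proof -
  have ZM [measurable]: "Z n \<in> measurable M (count_space UNIV)" for n
    using measurable_mono[of "count_space UNIV" "count_space UNIV" "F n" M] Z sub space by auto
  have "AE \<omega> in M. \<exists>n. K \<le> Z n \<omega>" for K
  proof -
    \<comment> \<open>\<open>nat\<close> truncates at 0, so \<open>a + int d\<close> is the larger
      of \<open>a\<close> and \<open>K\<close>; reaching it implies reaching
      \<open>K\<close>.\<close>
    define d where "d = nat (K - a)"
    define C where "C = {\<omega>\<in>space M. Z 0 \<omega> = a}"
    have C: "C \<in> sets (F 0)"
      using sets_Collect_count_space[OF Z[of 0], of "\<lambda>z. z = a"] by (simp only: C_def space)
    let ?W = "{\<omega>\<in>space M. \<forall>n. Z n \<omega> < a + int d}"
    have "measure M ?W \<le> stay_below j d * measure M C" for j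
    proof -
      have "measure M ?W \<le> measure M (C \<inter> {\<omega>\<in>space M. \<forall>m\<in>{0..0+j}. Z m \<omega> < a + int d})"
      proof (rule finite_measure_mono_AE)
        show "AE \<omega> in M. \<omega> \<in> ?W \<longrightarrow> \<omega> \<in> C \<inter> {\<omega>\<in>space M. \<forall>m\<in>{0..0+j}. Z m \<omega> < a + int d}"
          using start by eventually_elim (auto simp: C_def)
        show "C \<inter> {\<omega>\<in>space M. \<forall>m\<in>{0..0+j}. Z m \<omega> < a + int d} \<in> sets M"
          unfolding C_def by measurable
      qed
      also have "\<dots> \<le> stay_below j d * measure M C"
        by (rule measure_below_level_le[where F=F]) (use sub space mono Z steps half C in \<open>auto simp: C_def\<close>)
      finally show ?thesis .
    qed
    moreover have "(\<lambda>j. stay_below j d * measure M C) \<longlonglongrightarrow> 0"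
      by (intro tendsto_mult_left_zero stay_below_tendsto_0)
    ultimately have "measure M ?W \<le> 0"
      by (intro LIMSEQ_le_const) auto
    then have "measure M ?W = 0"
      by (simp add: measure_le_0_iff)
    moreover have "?W \<in> sets M"
      by measurable
    ultimately have "AE \<omega> in M. \<not> (\<forall>n. Z n \<omega> < a + int d)"
      by (intro AE_I[where N="?W"]) (auto simp: emeasure_eq_measure)
    then show ?thesis
    proof eventually_elim
      case (elim \<omega>)
      then obtain n where "a + int d \<le> Z n \<omega>"
        by (auto simp: not_less)
      then show ?case
        unfolding d_def by (intro exI[of _ n]) linarith
    qed
  qed
  then show ?thesis
    by (simp add: AE_all_countable)
qed

subsection \<open>Pairs of integer paths\<close>

text \<open>If \<open>y\<close> visits \<open>b\<close> infinitely often, it steps left from every site above \<open>b\<close> infinitely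
  often, so \<open>x\<close> visits each of these sites at most once.  As \<open>x\<close> is unbounded above, it finally
  moves right in every step; \<open>y\<close>, losing two units with each left step, can then no longer keep up with
  the front \<open>x\<close>, which thus always finds unvisited sites.\<close>

lemma finite_visits:
  fixes x y :: "nat \<Rightarrow> int"
  assumes x: "\<And>n. x (Suc n) - x n \<in> {-1, 1}" and y: "\<And>n. y (Suc n) - y n \<in> {-1, 1}"
    and y_left: "\<And>n. y (Suc n) \<noteq> y n + 1 \<Longrightarrow> card {m. m \<le> n \<and> x m = y n} \<le> 1"
    and y_right: "\<And>z. \<exists>\<^sub>\<infinity>n. y n = z \<Longrightarrow> \<exists>\<^sub>\<infinity>n. y n = z \<and> y (Suc n) = z + 1"
    and x_unbounded: "\<And>K. \<exists>n. K \<le> x n"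
    and x_left: "\<exists>\<^sub>\<infinity>n. card {m. m \<le> n \<and> y m = x n} \<le> 1 \<Longrightarrow>
      \<exists>\<^sub>\<infinity>n. card {m. m \<le> n \<and> y m = x n} \<le> 1 \<and> x (Suc n) \<noteq> x n + 1"
  shows "\<not> (\<exists>\<^sub>\<infinity>n. y n = b)"
proof
  assume b: "\<exists>\<^sub>\<infinity>n. y n = b"
  \<comment> \<open>Recurrence spreads upwards: infinitely many right steps from a site give
    infinitely many visits to the next one.\<close>
  have all: "\<exists>\<^sub>\<infinity>n. y n = b + int k" for k
  proof (induction k)
    case (Suc k)
    show ?case
      unfolding INFM_nat
    proof
      fix N
      obtain n where "N < n" "y n = b + int k" "y (Suc n) = b + int k + 1"
        using y_right[OF Suc] unfolding INFM_nat by blast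
      then show "\<exists>n>N. y n = b + int (Suc k)"
        by (intro exI[of _ "Suc n"]) auto
    qed
  qed (use b in simp)
  have down: "\<exists>n\<ge>N. y n = z \<and> y (Suc n) = z - 1" if "b < z" for z N
  proof -
    have all': "\<exists>m>N. y m = b + int k" for k N
      using all[of k] by (auto simp: INFM_nat)
    obtain i where i: "N < i" "y i = z"
      using all'[of N "nat (z - b)"] \<open>b < z\<close> by auto
    obtain j where j: "i < j" "y j = z - 1"
      using all'[of i "nat (z - 1 - b)"] \<open>b < z\<close> by auto
    \<comment> \<open>Between a visit to \<open>z\<close> and a later visit to \<open>z - 1\<close>,
      the first passage below \<open>z\<close> must be a step from \<open>z\<close> to
      \<open>z - 1\<close>.\<close>
    define l where "l = (LEAST l. i < l \<and> y l < z)"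
    have l: "i < l" "y l < z"
      unfolding l_def using j LeastI[of "\<lambda>l. i < l \<and> y l < z" j] by auto
    have "\<not> (i < l - 1 \<and> y (l - 1) < z)"
      using not_less_Least[of "l - 1" "\<lambda>l. i < l \<and> y l < z"] l unfolding l_def[symmetric] by simp
    then have "z \<le> y (l - 1)"
      using i l(1) by (cases "i = l - 1") auto
    then have "y (l - 1) = z \<and> y (Suc (l - 1)) = z - 1"
      using l y[of "l - 1"] by auto
    then show ?thesis
      using i l by (intro exI[of _ "l - 1"]) auto
  qed
  \<comment> \<open>Take a left step of \<open>y\<close> from the site \<open>x n\<close> later than
    both times. By \<open>y_left\<close>, \<open>x\<close> has been there at most once until
    then.\<close>
  have x_once: "m = n" if eq: "x m = x n" and gt: "b < x n" for m n
  proof -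
    obtain k where k: "max m n \<le> k" "y k = x n" "y (Suc k) = x n - 1"
      using down[OF gt] by metis
    then have "card {i. i \<le> k \<and> x i = x n} \<le> 1"
      using y_left[of k] by auto
    moreover have "m \<in> {i. i \<le> k \<and> x i = x n}" "n \<in> {i. i \<le> k \<and> x i = x n}"
      using k eq by auto
    ultimately show "m = n"
      using card_le_Suc0_iff_eq[of "{i. i \<le> k \<and> x i = x n}"] by simp
  qed
  have ivt: "\<exists>n\<ge>m. x n = z" if "x m \<le> z" "z \<le> x k" "m \<le> k" for m k z
  proof -
    have "\<bar>x (i + 1) - x i\<bar> \<le> 1" for i
      using x[of i] by auto
    then have "\<exists>n. m \<le> n \<and> n \<le> k \<and> x n = z"
      using that by (intro nat_intermed_int_val) auto
    then show ?thesis
      by blast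
  qed
  obtain T where "b + 1 \<le> x T"
    using x_unbounded by blast
  then have T: "b < x T"
    by simp
  \<comment> \<open>After a left step, \<open>x\<close> must cross its old site again to exceed its
    past maximum, contradicting \<open>x_once\<close>.\<close>
  have forward: "x (Suc n) = x n + 1" if "b < x n" for n
  proof (rule ccontr)
    assume "x (Suc n) \<noteq> x n + 1"
    then have "x (Suc n) < x n"
      using x[of n] by auto
    moreover obtain k where "Max (x ` {..n}) + 1 \<le> x k"
      using x_unbounded by blast
    moreover from this have less: "x i < x k" if "i \<le> n" for i
    proof -
      have "x i \<le> Max (x ` {..n})"
        using that by (intro Max_ge) auto
      then show ?thesis
        using \<open>Max (x ` {..n}) + 1 \<le> x k\<close> by linarith
    qed
    moreover have "\<not> k \<le> n"
      using less by blast
    ultimately obtain j where "Suc n \<le> j" "x j = x n"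
      using ivt[of "Suc n" "x n" k] by fastforce
    then show False
      using x_once[of j n] that by auto
  qed
  have x_eq: "x (T + k) = x T + int k" for k
  proof (induction k)
    case (Suc k)
    then show ?case
      using forward[of "T + k"] T by simp
  qed simp
  have slow: "y (m + k) \<le> y m + int k" for m k
  proof (induction k)
    case (Suc k)
    then show ?case
      using y[of "m + k"] by auto
  qed simp
  \<comment> \<open>The speed bound gives \<open>y 0 + int n\<close>, and each of the infinitely
    many left steps from \<open>b + 1\<close> lowers the bound by 2 for good.\<close>
  have lag: "\<exists>N. \<forall>n\<ge>N. y n \<le> y 0 + int n - 2 * int d" for d
  proof (induction d)
    case 0
    show ?case
      using slow[of 0] by auto
  next
    case (Suc d)
    then obtain N where N: "\<And>n. N \<le> n \<Longrightarrow> y n \<le> y 0 + int n - 2 * int d"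
      by blast
    obtain n where n: "N \<le> n" "y (Suc n) = y n - 1"
      using down[of "b + 1" N] by auto
    show ?case
    proof (intro exI[of _ "Suc n"] allI impI)
      fix m assume "Suc n \<le> m"
      then show "y m \<le> y 0 + int m - 2 * int (Suc d)"
        using slow[of "Suc n" "m - Suc n"] N[OF n(1)] n(2) by (simp add: of_nat_diff)
    qed
  qed
  \<comment> \<open>\<open>int d\<close> exceeds the head start of the line \<open>y 0 + n\<close>
    over the front \<open>x T + n - T\<close>; a lag of \<open>2 * d\<close> therefore puts
    \<open>y\<close> strictly behind the front.\<close>
  define d where "d = nat (y 0 + int T - x T + 1)"
  obtain N where N: "\<And>n. N \<le> n \<Longrightarrow> y n \<le> y 0 + int n - 2 * int d"
    using lag[of d] by blast
  \<comment> \<open>For visits of \<open>y\<close> at times before \<open>N\<close>, where the lag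
    is not yet available, the additional \<open>N + d\<close> steps of \<open>x\<close> carry the
    front past them.\<close>
  define N' where "N' = T + N + d"
  have unvisited: "y m \<noteq> x n" if "m \<le> n" "N' \<le> n" for m n
  proof -
    have "x n = x T + int n - int T"
      using x_eq[of "n - T"] that by (simp add: N'_def of_nat_diff)
    moreover have "y m \<le> y 0 + int m"
      using slow[of 0 m] by simp
    moreover have "y 0 + int T - x T < int d"
      unfolding d_def by linarith
    ultimately show ?thesis
      using that N[of m] unfolding N'_def by (cases "N \<le> m") auto
  qed
  \<comment> \<open>From \<open>N'\<close> on, \<open>x\<close> is always at a site new to
    \<open>y\<close>, so \<open>x_left\<close> yields a left step of \<open>x\<close> beyond time
    \<open>T\<close>, against \<open>forward\<close>.\<close>
  have empty: "card {m. m \<le> n \<and> y m = x n} = 0" if "N' \<le> n" for n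
    using unvisited[OF _ that] by auto
  have "\<exists>\<^sub>\<infinity>n. card {m. m \<le> n \<and> y m = x n} \<le> 1"
    unfolding INFM_nat_le
  proof
    fix i
    show "\<exists>n\<ge>i. card {m. m \<le> n \<and> y m = x n} \<le> 1"
      using empty[OF max.cobounded2[of N' i]] by (intro exI[of _ "max i N'"] conjI) linarith+
  qed
  then obtain n where "T \<le> n" "x (Suc n) \<noteq> x n + 1"
    using x_left unfolding INFM_nat_le by blast
  then show False
    using forward[of n] x_eq[of "n - T"] T by simp
qed

subsection \<open>One step of the mutually excited walk\<close>

lemma sets_merw_filtration_subset:
  assumes "\<And>n. X n \<in> measurable M (count_space UNIV)"
    and "\<And>n. Y n \<in> measurable M (count_space UNIV)"
  shows "sets (merw_filtration M X Y n) \<subseteq> sets M"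
  using subalgebra_merw_filtration[OF assms] by (simp add: subalgebra_def)

lemma space_merw_filtration: "space (merw_filtration M X Y n) = space M"
  unfolding merw_filtration_def by (rule space_measure_of) auto

lemma sets_merw_filtration:
  "sets (merw_filtration M X Y n) = sigma_sets (space M)
     ({X m -` A \<inter> space M | m A. m \<le> n} \<union> {Y m -` A \<inter> space M | m A. m \<le> n})"
  unfolding merw_filtration_def by (rule sets_measure_of) auto

lemma sets_merw_filtration_mono:
  "m \<le> n \<Longrightarrow> sets (merw_filtration M X Y m) \<subseteq> sets (merw_filtration M X Y n)"
  unfolding sets_merw_filtration by (intro sigma_sets_mono' Un_mono) (blast intro: order_trans)+

lemma measurable_merw_filtration:
  assumes "m \<le> n"
  shows "X m \<in> measurable (merw_filtration M X Y n) (count_space UNIV)"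
    and "Y m \<in> measurable (merw_filtration M X Y n) (count_space UNIV)"
  unfolding measurable_def space_merw_filtration sets_merw_filtration
  using assms by (auto, (blast intro: sigma_sets.Basic)+)

lemma measurable_card_visits:
  "(\<lambda>\<omega>. card {m. m \<le> n \<and> Y m \<omega> = X n \<omega>})
    \<in> measurable (merw_filtration M X Y n) (count_space UNIV)"
proof -
  let ?F = "merw_filtration M X Y n"
  have [measurable]: "X n \<in> measurable ?F (count_space UNIV)"
    "Y (min m n) \<in> measurable ?F (count_space UNIV)" for m
    by (rule measurable_merw_filtration; simp)+
  \<comment> \<open>Replacing \<open>m\<close> by \<open>min m n\<close> makes the summand
    measurable for every \<open>m\<close>; in the range of summation the two agree.\<close>
  have "(\<lambda>\<omega>. \<Sum>m\<le>n. if Y (min m n) \<omega> = X n \<omega> then 1 else 0 :: nat)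
      \<in> measurable ?F (count_space UNIV)"
    by measurable
  also have "(\<lambda>\<omega>. \<Sum>m\<le>n. if Y (min m n) \<omega> = X n \<omega> then 1 else 0)
      = (\<lambda>\<omega>. \<Sum>m\<le>n. if Y m \<omega> = X n \<omega> then 1 else 0)"
    by (intro ext sum.cong) auto
  also have "\<dots> = (\<lambda>\<omega>. card {m. m \<le> n \<and> Y m \<omega> = X n \<omega>})"
    by (simp add: sum.If_cases Int_def)
  finally show ?thesis .
qed

section \<open>Symmetry between the two walks\<close>

lemma merw_filtration_commute: "merw_filtration M Y X n = merw_filtration M X Y n"
  unfolding merw_filtration_def by (simp add: Un_commute)

lemma cond_indep_var_commute:
  assumes "cond_indep_var M F Ma U Mb V"
  shows "cond_indep_var M F Mb V Ma U"
  unfolding cond_indep_var_def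
proof (intro conjI ballI)
  fix B A assume "B \<in> sets Mb" "A \<in> sets Ma"
  then have "AE \<omega> in M. cond_probability M F {\<omega> \<in> space M. U \<omega> \<in> A \<and> V \<omega> \<in> B} \<omega> =
        cond_probability M F {\<omega> \<in> space M. U \<omega> \<in> A} \<omega> *
        cond_probability M F {\<omega> \<in> space M. V \<omega> \<in> B} \<omega>"
    using assms unfolding cond_indep_var_def by blast
  then show "AE \<omega> in M. cond_probability M F {\<omega> \<in> space M. V \<omega> \<in> B \<and> U \<omega> \<in> A} \<omega> =
        cond_probability M F {\<omega> \<in> space M. V \<omega> \<in> B} \<omega> *
        cond_probability M F {\<omega> \<in> space M. U \<omega> \<in> A} \<omega>"
    by (simp only: conj_commute mult.commute)
qed (use assms in \<open>auto simp: cond_indep_var_def\<close>)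

text \<open>Transfers every result about the first process to the second one.\<close>

lemma (in mutually_excited_random_walk) swap: "mutually_excited_random_walk M Y X p"
proof
  show "AE \<omega> in M. Y 0 \<omega> = 0 \<and> X 0 \<omega> = 0"
    using start by auto
  show "AE \<omega> in M. Y (Suc n) \<omega> - Y n \<omega> \<in> {-1, 1} \<and> X (Suc n) \<omega> - X n \<omega> \<in> {-1, 1}" for n
    using steps[of n] by eventually_elim blast
  show "cond_indep_var M (merw_filtration M Y X n)
          (count_space UNIV) (\<lambda>\<omega>. Y (Suc n) \<omega> - Y n \<omega>)
          (count_space UNIV) (\<lambda>\<omega>. X (Suc n) \<omega> - X n \<omega>)" for n
    unfolding merw_filtration_commute[of M Y X] by (rule cond_indep_var_commute[OF steps_cond_indep])
qed (simp_all only: X_measurable Y_measurable X_step Y_step merw_filtration_commute[of M Y X])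

section \<open>Mass of right steps on events of the past\<close>

lemma (in mutually_excited_random_walk) sets_filtration_subset:
  "sets (merw_filtration M X Y n) \<subseteq> sets M"
  by (rule sets_merw_filtration_subset[OF X_measurable Y_measurable])

text \<open>The defining property of conditional expectation, integrated over an event
  \<open>C\<close> of the past. The weight is integrable because it is bounded by the larger of 1/2
  and the absolute value of \<open>p\<close>.\<close>

lemma (in mutually_excited_random_walk) measure_inter_right_step:
  assumes C: "C \<in> sets (merw_filtration M X Y n)"
  shows "measure M (C \<inter> {\<omega>\<in>space M. X (Suc n) \<omega> = X n \<omega> + 1})
    = (\<integral>\<omega>\<in>C. merw_weight p (card {m. m \<le> n \<and> Y m \<omega> = X n \<omega>}) \<partial>M)"
    and "set_integrable M C (\<lambda>\<omega>. merw_weight p (card {m. m \<le> n \<and> Y m \<omega> = X n \<omega>}))"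
proof -
  note [measurable] = X_measurable Y_measurable
  let ?F = "merw_filtration M X Y n" and ?R = "{\<omega>\<in>space M. X (Suc n) \<omega> = X n \<omega> + 1}"
  let ?w = "\<lambda>\<omega>. merw_weight p (card {m. m \<le> n \<and> Y m \<omega> = X n \<omega>})"
  have F: "sigma_finite_subalgebra M ?F"
    using finite_measure_axioms subalgebra_merw_filtration[OF X_measurable Y_measurable]
    by (intro finite_measure_subalgebra_is_sigma_finite finite_measure_subalgebra.intro
        finite_measure_subalgebra_axioms.intro)
  have CM [measurable]: "C \<in> sets M"
    by (rule subsetD[OF sets_filtration_subset C])
  have [measurable]: "(\<lambda>\<omega>. card {m. m \<le> n \<and> Y m \<omega> = X n \<omega>}) \<in> measurable M (count_space UNIV)"
    by (rule measurable_from_subalg[OF subalgebra_merw_filtration measurable_card_visits])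
      (rule X_measurable Y_measurable)+
  have R: "?R \<in> sets M"
    by measurable
  have int: "integrable M (indicator ?R :: 'a \<Rightarrow> real)"
    using R by (simp add: emeasure_eq_measure)
  have "integrable M ?w"
    by (rule integrable_const_bound[where B="max (1/2) \<bar>p\<bar>"]) (auto simp: merw_weight_def)
  then show "set_integrable M C ?w"
    unfolding set_integrable_def by (rule integrable_mult_indicator[OF CM])
  have "measure M (C \<inter> ?R) = (\<integral>\<omega>\<in>C. indicator ?R \<omega> \<partial>M)"
    using R by (simp add: set_lebesgue_integral_def indicator_inter_arith[symmetric])
  also have "\<dots> = (\<integral>\<omega>\<in>C. real_cond_exp M ?F (indicator ?R) \<omega> \<partial>M)"
    by (rule sigma_finite_subalgebra.real_cond_exp_intA[OF F int C])
  also have "\<dots> = (\<integral>\<omega>\<in>C. ?w \<omega> \<partial>M)"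
    by (intro set_lebesgue_integral_cong_AE)
      (use X_step[of n] in \<open>auto simp: cond_probability_def borel_measurable_cond_exp2\<close>)
  finally show "measure M (C \<inter> ?R) = (\<integral>\<omega>\<in>C. ?w \<omega> \<partial>M)" .
qed

text \<open>Applied with \<open>a = 1 / 2\<close> on every event of the past, and with
  \<open>a = 1\<close> where the other walk has visited the current site at least twice.\<close>

lemma (in mutually_excited_random_walk) measure_inter_right_step_ge:
  assumes C: "C \<in> sets (merw_filtration M X Y n)"
    and a: "\<And>\<omega>. \<omega> \<in> C \<Longrightarrow> a \<le> merw_weight p (card {m. m \<le> n \<and> Y m \<omega> = X n \<omega>})"
  shows "a * measure M C \<le> measure M (C \<inter> {\<omega>\<in>space M. X (Suc n) \<omega> = X n \<omega> + 1})"
proof -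
  have CM [measurable]: "C \<in> sets M"
    by (rule subsetD[OF sets_filtration_subset C])
  have const: "set_integrable M C (\<lambda>_. a)"
    using CM by (simp add: set_integrable_def emeasure_eq_measure)
  have "a * measure M C = (\<integral>\<omega>\<in>C. a \<partial>M)"
    by (simp add: set_integral_const emeasure_eq_measure)
  also have "\<dots> \<le> (\<integral>\<omega>\<in>C. merw_weight p (card {m. m \<le> n \<and> Y m \<omega> = X n \<omega>}) \<partial>M)"
    by (intro set_integral_mono const measure_inter_right_step(2)[OF C] a)
  finally show ?thesis
    by (simp add: measure_inter_right_step(1)[OF C])
qed

lemma (in mutually_excited_random_walk) measure_inter_right_step_le:
  assumes C: "C \<in> sets (merw_filtration M X Y n)"
    and a: "\<And>\<omega>. \<omega> \<in> C \<Longrightarrow> merw_weight p (card {m. m \<le> n \<and> Y m \<omega> = X n \<omega>}) \<le> a"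
  shows "measure M (C \<inter> {\<omega>\<in>space M. X (Suc n) \<omega> = X n \<omega> + 1}) \<le> a * measure M C"
proof -
  have CM [measurable]: "C \<in> sets M"
    by (rule subsetD[OF sets_filtration_subset C])
  have const: "set_integrable M C (\<lambda>_. a)"
    using CM by (simp add: set_integrable_def emeasure_eq_measure)
  have "(\<integral>\<omega>\<in>C. merw_weight p (card {m. m \<le> n \<and> Y m \<omega> = X n \<omega>}) \<partial>M) \<le> (\<integral>\<omega>\<in>C. a \<partial>M)"
    by (intro set_integral_mono const measure_inter_right_step(2)[OF C] a)
  also have "\<dots> = a * measure M C"
    by (simp add: set_integral_const emeasure_eq_measure)
  finally show ?thesis
    by (simp add: measure_inter_right_step(1)[OF C])
qed

subsection \<open>Almost sure properties\<close>

lemma (in mutually_excited_random_walk) measure_inter_right_step_ge_half: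
  assumes "1 / 2 \<le> p" "C \<in> sets (merw_filtration M X Y n)"
  shows "measure M C / 2 \<le> measure M (C \<inter> {\<omega>\<in>space M. X (Suc n) \<omega> = X n \<omega> + 1})"
  using measure_inter_right_step_ge[OF assms(2), of "1 / 2"] assms(1)
  by (simp add: merw_weight_def)

lemma (in mutually_excited_random_walk) right_step_sets:
  shows "{\<omega>\<in>space M. X (Suc n) \<omega> = X n \<omega> + 1} \<in> sets (merw_filtration M X Y (Suc n))"
proof -
  have [measurable]: "X n \<in> measurable (merw_filtration M X Y (Suc n)) (count_space UNIV)"
    "X (Suc n) \<in> measurable (merw_filtration M X Y (Suc n)) (count_space UNIV)"
    by (rule measurable_merw_filtration; simp)+
  have "{\<omega>\<in>space (merw_filtration M X Y (Suc n)). X (Suc n) \<omega> = X n \<omega> + 1}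
      \<in> sets (merw_filtration M X Y (Suc n))"
    by measurable
  then show ?thesis
    by (simp only: space_merw_filtration)
qed

lemma (in mutually_excited_random_walk) card_visits_sets:
  "{\<omega>\<in>space M. P (card {m. m \<le> n \<and> Y m \<omega> = X n \<omega>})} \<in> sets (merw_filtration M X Y n)"
  using sets_Collect_count_space[where P=P,
      OF measurable_card_visits[where n=n and X=X and Y=Y and M=M]]
  by (simp only: space_merw_filtration)

lemma (in mutually_excited_random_walk) AE_unbounded_above:
  assumes "1 / 2 \<le> p"
  shows "AE \<omega> in M. \<forall>K. \<exists>n. K \<le> X n \<omega>"
proof (rule AE_exceeds_level[where F="merw_filtration M X Y" and a=0])
  show "AE \<omega> in M. X (Suc n) \<omega> - X n \<omega> \<in> {-1, 1}" for n
    using steps[of n] by eventually_elim blast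
  show "AE \<omega> in M. X 0 \<omega> = 0"
    using start by eventually_elim blast
qed (fact sets_filtration_subset space_merw_filtration measure_inter_right_step_ge_half[OF assms]
      | simp add: sets_merw_filtration_mono measurable_merw_filtration)+

lemma (in mutually_excited_random_walk) AE_frequently_right_step:
  assumes "1 / 2 \<le> p"
  shows "AE \<omega> in M. \<forall>z. (\<exists>\<^sub>\<infinity>n. X n \<omega> = z) \<longrightarrow> (\<exists>\<^sub>\<infinity>n. X n \<omega> = z \<and> X (Suc n) \<omega> = z + 1)"
proof -
  let ?F = "merw_filtration M X Y" and ?R = "\<lambda>n. {\<omega>\<in>space M. X (Suc n) \<omega> = X n \<omega> + 1}"
  have "AE \<omega> in M. (\<exists>\<^sub>\<infinity>n. X n \<omega> = z) \<longrightarrow> (\<exists>\<^sub>\<infinity>n. X n \<omega> = z \<and> X (Suc n) \<omega> = z + 1)" for z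
  proof -
    let ?A = "\<lambda>n. {\<omega>\<in>space M. X n \<omega> = z}"
    \<comment> \<open>Conditional Borel-Cantelli, where \<open>B\<close> is the failure to step
      right; given the past it has probability at most 1/2.\<close>
    have "AE \<omega> in M. (\<exists>\<^sub>\<infinity>n. \<omega> \<in> ?A n) \<longrightarrow> (\<exists>\<^sub>\<infinity>n. \<omega> \<in> ?A n \<and> \<omega> \<notin> space M - ?R n)"
    proof (rule AE_frequently_not_if_halving[where F="?F"])
      show "sets (?F n) \<subseteq> sets M" for n
        by (rule sets_filtration_subset)
      show "?A n \<in> sets (?F n)" for n
        using sets_Collect_count_space[where P="\<lambda>x. x = z",
            OF measurable_merw_filtration(1)[where m=n and n=n and X=X and Y=Y and M=M], OF order_refl]
        by (simp only: space_merw_filtration)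
      show "space M - ?R n \<in> sets (?F (Suc n))" for n
        using sets.compl_sets[OF right_step_sets[of n]] by (simp only: space_merw_filtration)
      show "measure M (C \<inter> (space M - ?R n)) \<le> measure M C / 2" if "C \<in> sets (?F n)" for n C
      proof -
        have C: "C \<in> sets M" and R: "?R n \<in> sets M"
          using subsetD[OF sets_filtration_subset] that right_step_sets by blast+
        have "C \<inter> (space M - ?R n) = C - ?R n"
          using sets.sets_into_space[OF C] by blast
        then show ?thesis
          using finite_measure_Diff'[OF C R] measure_inter_right_step_ge_half[OF assms that] by simp
      qed
    qed (simp_all add: sets_merw_filtration_mono space_merw_filtration)
    then show ?thesis
      using AE_space by eventually_elim (simp cong: conj_cong)
  qed
  then show ?thesis
    by (simp add: AE_all_countable)
qed

text \<open>Here the right step itself plays the part of \<open>B\<close>: its weight is exactly 1/2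
  after at most one visit of the other walk.\<close>

lemma (in mutually_excited_random_walk) AE_frequently_not_right_step:
  "AE \<omega> in M. (\<exists>\<^sub>\<infinity>n. card {m. m \<le> n \<and> Y m \<omega> = X n \<omega>} \<le> 1) \<longrightarrow>
    (\<exists>\<^sub>\<infinity>n. card {m. m \<le> n \<and> Y m \<omega> = X n \<omega>} \<le> 1 \<and> X (Suc n) \<omega> \<noteq> X n \<omega> + 1)"
proof -
  let ?F = "merw_filtration M X Y" and ?R = "\<lambda>n. {\<omega>\<in>space M. X (Suc n) \<omega> = X n \<omega> + 1}"
  let ?A = "\<lambda>n. {\<omega>\<in>space M. card {m. m \<le> n \<and> Y m \<omega> = X n \<omega>} \<le> 1}"
  have "AE \<omega> in M. (\<exists>\<^sub>\<infinity>n. \<omega> \<in> ?A n) \<longrightarrow> (\<exists>\<^sub>\<infinity>n. \<omega> \<in> ?A n \<and> \<omega> \<notin> ?R n)"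
  proof (rule AE_frequently_not_if_halving[where F="?F"])
    show "sets (?F n) \<subseteq> sets M" for n
      by (rule sets_filtration_subset)
    show "?A n \<in> sets (?F n)" for n
      by (rule card_visits_sets)
    show "?R n \<in> sets (?F (Suc n))" for n
      by (rule right_step_sets)
    show "measure M (C \<inter> ?R n) \<le> measure M C / 2" if "C \<in> sets (?F n)" "C \<subseteq> ?A n" for n C
    proof -
      have "merw_weight p (card {m. m \<le> n \<and> Y m \<omega> = X n \<omega>}) \<le> 1 / 2" if "\<omega> \<in> C" for \<omega>
        using subsetD[OF \<open>C \<subseteq> ?A n\<close> that] by (simp add: merw_weight_def)
      then show ?thesis
        using measure_inter_right_step_le[OF that(1), of "1 / 2"] by simp
    qed
  qed (simp_all add: sets_merw_filtration_mono space_merw_filtration)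
  then show ?thesis
    using AE_space by eventually_elim simp
qed

text \<open>For \<open>p = 1\<close> the weight is 1 after two visits, so the right steps exhaust
  the event \<open>?C\<close> up to a null set.\<close>

lemma (in mutually_excited_random_walk) AE_not_right_step_visits:
  assumes "p = 1"
  shows "AE \<omega> in M. \<forall>n. X (Suc n) \<omega> \<noteq> X n \<omega> + 1 \<longrightarrow> card {m. m \<le> n \<and> Y m \<omega> = X n \<omega>} \<le> 1"
proof -
  have "AE \<omega> in M. X (Suc n) \<omega> \<noteq> X n \<omega> + 1 \<longrightarrow> card {m. m \<le> n \<and> Y m \<omega> = X n \<omega>} \<le> 1" for n
  proof -
    let ?R = "{\<omega>\<in>space M. X (Suc n) \<omega> = X n \<omega> + 1}"
    let ?C = "{\<omega>\<in>space M. \<not> card {m. m \<le> n \<and> Y m \<omega> = X n \<omega>} \<le> 1}"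
    have CF: "?C \<in> sets (merw_filtration M X Y n)"
      by (rule card_visits_sets)
    have C: "?C \<in> sets M" and R: "?R \<in> sets M"
      using subsetD[OF sets_filtration_subset] CF right_step_sets by blast+
    have "1 \<le> merw_weight p (card {m. m \<le> n \<and> Y m \<omega> = X n \<omega>})" if "\<omega> \<in> ?C" for \<omega>
      using that assms by (simp add: merw_weight_def)
    then have "measure M ?C \<le> measure M (?C \<inter> ?R)"
      using measure_inter_right_step_ge[OF CF, of 1] by simp
    then have "measure M (?C - ?R) = 0"
      using finite_measure_Diff'[OF C R] measure_nonneg[of M "?C - ?R"] by linarith
    then have "?C - ?R \<in> null_sets M"
      using C R by (intro null_setsI sets.Diff) (simp_all only: emeasure_eq_measure ennreal_0)
    then show ?thesis
      by (rule AE_I') blast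
  qed
  then show ?thesis
    by (simp add: AE_all_countable)
qed

lemma (in mutually_excited_random_walk) AE_finite_visits:
  assumes "p = 1"
  shows "AE \<omega> in M. \<forall>z. \<not> (\<exists>\<^sub>\<infinity>n. Y n \<omega> = z)"
proof -
  have half: "1 / 2 \<le> p"
    using assms by simp
  have "AE \<omega> in M. \<forall>n. X (Suc n) \<omega> - X n \<omega> \<in> {-1, 1} \<and> Y (Suc n) \<omega> - Y n \<omega> \<in> {-1, 1}"
    unfolding AE_all_countable using steps by blast
  \<comment> \<open>\<open>finite_visits\<close> is applied path by path; the properties of
    \<open>Y\<close> come through \<open>swap\<close>, those of \<open>X\<close> directly.\<close>
  then show ?thesis
    using mutually_excited_random_walk.AE_frequently_right_step[OF swap half]
      mutually_excited_random_walk.AE_not_right_step_visits[OF swap assms]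
      AE_unbounded_above[OF half] AE_frequently_not_right_step
  proof eventually_elim
    case (elim \<omega>)
    show ?case
    proof
      fix z
      show "\<not> (\<exists>\<^sub>\<infinity>n. Y n \<omega> = z)"
        by (rule finite_visits[of "\<lambda>n. X n \<omega>" "\<lambda>n. Y n \<omega>"]) (use elim in blast)+
    qed
  qed
qed

text \<open>Measurability of the event turns "probability 1" into "almost surely".\<close>

lemma (in prob_space) transientI:
  assumes [measurable]: "\<And>n. \<xi> n \<in> measurable M (count_space UNIV)"
    and "AE \<omega> in M. \<forall>z. \<not> (\<exists>\<^sub>\<infinity>n. \<xi> n \<omega> = z)"
  shows "transient M \<xi>"
proof -
  have "{\<omega> \<in> space M. \<forall>z. \<exists>n. \<forall>m>n. \<xi> m \<omega> \<noteq> z} \<in> sets M"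
    by measurable
  then show ?thesis
    using assms(2) unfolding transient_def by (subst prob_Collect_eq_1) (auto simp: INFM_nat)
qed

theorem proposition3p1:
  fixes M :: "'a measure" and X Y :: "nat \<Rightarrow> 'a \<Rightarrow> int"
  assumes "mutually_excited_random_walk M X Y 1"
  shows "transient M X \<and> transient M Y"
proof -
  interpret mutually_excited_random_walk M X Y 1
    by (rule assms)
  have "transient M X"
    using mutually_excited_random_walk.AE_finite_visits[OF swap refl] X_measurable
    by (intro transientI)
  moreover have "transient M Y"
    using AE_finite_visits[OF refl] Y_measurable by (intro transientI)
  ultimately show ?thesis ..
qed

end
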